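(* Let $f:\{2,3,4,\ldots\}\to(0,\infty)$ be a function such that $f(2)>1$ and $$ \left(1-\sqrt{\frac{m}{f(m)}}\right)^2 f(m)\geq f(m-1)\qquad\text{for every } m=3,4,\ldots. $$ Let $m\ge 2$ be an integer, and let $G$ be a finite group of order $n$ such that no nontrivial representation of $G$ has dimension less than $\delta$, where $\delta>0$. For every $1\leq i\leq m$ let $A_i$ be a subset of $G$ with density $p_i$, and for every $1\leq i<j\leq m$ let $A_{ij}$ be a subset of $G$ with density $p_{ij}$. Suppose that for all $1\leq i<j\leq m$ the $(i,j)$-density product $P_{ij}$ satisfies $P_{ij}\geq f(m)/\delta$. Then there exist elements $x_1,\ldots,x_m$ of $G$ such that $x_ix_j\in A_{ij}$ for every $1\leq i<j\leq m$.
   Context: The density of a subset $A$ of a finite group $G$ of order $n$ is $|A|/n$. Representations are finite-dimensional complex linear representations; a representation is nontrivial if some group element does not act as the identity. For $1\leq i<j\leq m$, the $(i,j)$-density product is $$ P_{ij}=p_i\,p_j\,p_{ij}\prod_{k=1}^{i-1}(p_{ki}\,p_{kj}), $$ where the product over $k$ is empty (equal to $1$) when $i=1$.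
   Formalization: The formal theorem also assumes f(k) ≥ k for every k ≥ 3, so that 1−√(k/f(k)) is nonnegative; as printed the claim fails, e.g. f(2)=3/2, f(3)=1/100, f(k)=16^k for k ≥ 4, m=3, G=Z/2, δ=1, A_i=G, A_12=A_13={0}, A_23={1}. *)

theory Defs
  imports "HOL-Algebra.Algebra" "Jordan_Normal_Form.Matrix"
begin

definition set_density :: "('a, 'b) monoid_scheme \<Rightarrow> 'a set \<Rightarrow> real" where
  "set_density G A = real (card A) / real (order G)"

definition complex_GL :: "nat \<Rightarrow> complex mat monoid" where
  "complex_GL d = units_of (ring_mat TYPE(complex) d ())"

text \<open>A d-dimensional complex representation, given by matrices with respect to a basis.
  In dimension 0 there is only the trivial one.\<close>

definition representation :: "('a, 'b) monoid_scheme \<Rightarrow> nat \<Rightarrow> ('a \<Rightarrow> complex mat) \<Rightarrow> bool" where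
  "representation G d \<rho> \<longleftrightarrow> \<rho> \<in> hom G (complex_GL d)"

definition nontrivial_representation ::
    "('a, 'b) monoid_scheme \<Rightarrow> nat \<Rightarrow> ('a \<Rightarrow> complex mat) \<Rightarrow> bool" where
  "nontrivial_representation G d \<rho> \<longleftrightarrow>
     representation G d \<rho> \<and> (\<exists>g\<in>carrier G. \<rho> g \<noteq> 1\<^sub>m d)"

text \<open>Indices start at 1; \<open>p\<close> holds the vertex densities and \<open>q k l\<close>, for \<open>k < l\<close>,
  the edge densities.\<close>

definition density_product ::
    "(nat \<Rightarrow> real) \<Rightarrow> (nat \<Rightarrow> nat \<Rightarrow> real) \<Rightarrow> nat \<Rightarrow> nat \<Rightarrow> real" where
  "density_product p q i j = p i * p j * q i j * (\<Prod>k = 1..<i. q k i * q k j)"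

end

theory Submission
  imports Defs "HOL-Analysis.Function_Topology"
begin

text \<open>
A group without small nontrivial representations is quasirandom: for every set \<open>A\<close>, the bipartite
graph in which \<open>x\<close> and \<open>y\<close> are joined when \<open>x \<otimes> y \<in> A\<close> behaves like a random graph of the same
density. The reason is a multiplicity argument. On functions with sum zero, the functions that the
adjacency matrix stretches the most form a subspace that is invariant under left translation and
contains no nonzero constant. The group acts nontrivially on it, so its dimension is at least
\<open>\<delta>\<close>. The square of the largest singular value orthogonal to the constants is therefore counted at
least \<open>\<delta>\<close> times in the squared Hilbert--Schmidt norm of the matrix, which is \<open>n |A|\<close> for a group of
order \<open>n\<close>, and so it is at most \<open>n |A| / \<delta>\<close> (lemma \<open>product_graph_norm_bound\<close>).

By Chebyshev's inequality, all but a proportion \<open>1 / (t\<^sup>2 p q \<delta>)\<close> of the \<open>x\<close> have more than the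
fraction \<open>1 - t\<close> of the expected number of neighbours in a set of density \<open>q\<close>, where \<open>p\<close> is the
density of \<open>A\<close> (lemma \<open>few_poor_vertices\<close>). One then picks the elements greedily: an element \<open>x\<close> of
the first set that is typical with respect to all the later sets is fixed, each later set is
restricted to the neighbours of \<open>x\<close>, and induction on \<open>m\<close> applies to the restricted sets (lemma
\<open>exists_elements_with_prescribed_products\<close>).

Everything happens in finite-dimensional spaces of real functions on the group, where a maximiser
of the Rayleigh quotient and a maximal orthonormal system take the place of the spectral theorem.
\<close>

section \<open>Orthonormal systems of real functions on a finite set\<close>

definition dot_on :: "'a set \<Rightarrow> ('a \<Rightarrow> real) \<Rightarrow> ('a \<Rightarrow> real) \<Rightarrow> real" where
  "dot_on S f g = (\<Sum>x\<in>S. f x * g x)"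

text \<open>The functions live on the whole type but vanish off \<open>S\<close>, so that equality on \<open>S\<close> is equality of
functions. Closure under two-term linear combinations covers sums, multiples and, the set
being nonempty, the zero function.\<close>

definition function_subspace :: "'a set \<Rightarrow> ('a \<Rightarrow> real) set \<Rightarrow> bool" where
  "function_subspace S E \<longleftrightarrow> E \<noteq> {} \<and> (\<forall>f\<in>E. \<forall>x. x \<notin> S \<longrightarrow> f x = 0) \<and>
     (\<forall>f\<in>E. \<forall>g\<in>E. \<forall>a b. (\<lambda>x. a * f x + b * g x) \<in> E)"

definition orthonormal_on :: "'a set \<Rightarrow> nat \<Rightarrow> (nat \<Rightarrow> 'a \<Rightarrow> real) \<Rightarrow> bool" where
  "orthonormal_on S d e \<longleftrightarrow>
     (\<forall>i<d. \<forall>j<d. dot_on S (e i) (e j) = (if i = j then 1 else 0))"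

lemma dot_on_commute: "dot_on S f g = dot_on S g f"
  by (simp add: dot_on_def mult.commute)

lemma dot_on_nonneg: "dot_on S f f \<ge> 0"
  by (simp add: dot_on_def sum_nonneg)

lemma dot_on_eq_0_iff:
  "finite S \<Longrightarrow> dot_on S f f = 0 \<longleftrightarrow> (\<forall>x\<in>S. f x = 0)"
  by (simp add: dot_on_def sum_nonneg_eq_0_iff)

lemma dot_on_lincomb_left:
  "dot_on S (\<lambda>x. a * f x + b * g x) h = a * dot_on S f h + b * dot_on S g h"
  by (simp add: dot_on_def sum_distrib_left sum.distrib algebra_simps)

lemma dot_on_lincomb_right:
  "dot_on S h (\<lambda>x. a * f x + b * g x) = a * dot_on S h f + b * dot_on S h g"
  by (simp add: dot_on_def sum_distrib_left sum.distrib algebra_simps)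

lemma dot_on_diff_left: "dot_on S (\<lambda>x. f x - g x) h = dot_on S f h - dot_on S g h"
  by (simp add: dot_on_def sum_subtractf algebra_simps)

lemma dot_on_diff_right: "dot_on S h (\<lambda>x. f x - g x) = dot_on S h f - dot_on S h g"
  by (simp add: dot_on_def sum_subtractf algebra_simps)

lemma dot_on_sum_right:
  "dot_on S f (\<lambda>x. \<Sum>i<d. c i * e i x) = (\<Sum>i<(d::nat). c i * dot_on S f (e i))"
  unfolding dot_on_def sum_distrib_left
  by (subst sum.swap) (simp add: mult_ac)

lemma function_subspace_lincomb:
  assumes "function_subspace S E" "f \<in> E" "g \<in> E"
  shows "(\<lambda>x. a * f x + b * g x) \<in> E"
  using assms unfolding function_subspace_def by blast

lemma function_subspace_sum:
  assumes "function_subspace S E" "\<And>i. i < d \<Longrightarrow> e i \<in> E"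
  shows "(\<lambda>x. \<Sum>i<(d::nat). c i * e i x) \<in> E"
  using assms(2)
proof (induction d)
  case 0
  obtain f where "f \<in> E" using assms(1) by (auto simp: function_subspace_def)
  then have "(\<lambda>x. 0 * f x + 0 * f x) \<in> E"
    using function_subspace_lincomb[OF assms(1)] by blast
  then show ?case by simp
next
  case (Suc d)
  have "(\<lambda>x. 1 * (\<Sum>i<d. c i * e i x) + c d * e d x) \<in> E"
    using Suc.IH Suc.prems by (intro function_subspace_lincomb[OF assms(1)]) simp_all
  then show ?case by simp
qed

lemma orthonormal_residual:
  assumes "orthonormal_on S d e" and "j < d"
  shows "dot_on S (\<lambda>x. f x - (\<Sum>i<d. dot_on S f (e i) * e i x)) (e j) = 0"
proof -
  have "dot_on S (e j) (\<lambda>x. \<Sum>i<d. dot_on S f (e i) * e i x)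
      = (\<Sum>i<d. dot_on S f (e i) * (if j = i then 1 else 0))"
    using assms by (simp add: dot_on_sum_right orthonormal_on_def)
  also have "\<dots> = (\<Sum>i<d. if j = i then dot_on S f (e i) else 0)"
    by (rule sum.cong) auto
  also have "\<dots> = dot_on S f (e j)" using assms(2) by simp
  finally show ?thesis by (simp add: dot_on_diff_left dot_on_commute)
qed

lemma Bessel_inequality:
  assumes "orthonormal_on S d e"
  shows "(\<Sum>i<d. (dot_on S f (e i))\<^sup>2) \<le> dot_on S f f"
proof -
  define h where "h = (\<lambda>x. \<Sum>i<d. dot_on S f (e i) * e i x)"
  define r where "r = (\<lambda>x. f x - h x)"
  have "dot_on S r h = (\<Sum>i<d. dot_on S f (e i) * dot_on S r (e i))"
    by (simp add: h_def dot_on_sum_right)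
  also have "\<dots> = 0"
    using orthonormal_residual[OF assms] by (simp add: r_def h_def)
  finally have "dot_on S f h - dot_on S h h = 0" by (simp add: r_def dot_on_diff_left)
  moreover have "dot_on S f h = (\<Sum>i<d. (dot_on S f (e i))\<^sup>2)"
    by (simp add: h_def dot_on_sum_right power2_eq_square)
  moreover have "dot_on S r r = dot_on S f f - 2 * dot_on S f h + dot_on S h h"
    by (simp add: r_def dot_on_diff_left dot_on_diff_right dot_on_commute[of S h f])
  ultimately show ?thesis using dot_on_nonneg[of S r] by linarith
qed

text \<open>Bessel's inequality for the point mass at \<open>x\<close> gives \<open>\<Sum>i<d. (e i x)\<^sup>2 \<le> 1\<close>; summing over \<open>x\<close> counts each
of the \<open>d\<close> unit vectors once.\<close>

lemma orthonormal_length_le_card: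
  assumes "finite S" and "orthonormal_on S d e"
  shows "d \<le> card S"
proof -
  have "real d = (\<Sum>i<d. dot_on S (e i) (e i))"
    using assms(2) by (simp add: orthonormal_on_def)
  also have "\<dots> = (\<Sum>x\<in>S. \<Sum>i<d. (e i x)\<^sup>2)"
    unfolding dot_on_def by (subst sum.swap) (simp add: power2_eq_square)
  also have "\<dots> \<le> (\<Sum>x\<in>S. 1)"
  proof (rule sum_mono)
    fix x assume x: "x \<in> S"
    have pick: "dot_on S (\<lambda>y. if y = x then 1 else 0) h = h x" for h
      using x assms(1) by (simp add: dot_on_def if_distrib[of "\<lambda>c. c * _"] cong: if_cong)
    show "(\<Sum>i<d. (e i x)\<^sup>2) \<le> 1"
      using Bessel_inequality[OF assms(2), of "\<lambda>y. if y = x then 1 else 0"] by (simp add: pick)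
  qed
  finally show ?thesis by simp
qed

text \<open>An orthonormal system of maximal length inside \<open>E\<close> spans \<open>E\<close>: if some \<open>f\<close> in \<open>E\<close> differed from its
projection, the normalised difference would extend the system. Lengths are bounded by
\<open>card S\<close>, so a maximum exists. The coefficients in such a basis are inner products, which
is what makes the matrix entries of a representation explicit later on.\<close>

lemma orthonormal_basis_exists:
  assumes fin: "finite S" and E: "function_subspace S E"
  obtains d e where "orthonormal_on S d e" and "\<And>i. i < d \<Longrightarrow> e i \<in> E"
    and "\<And>f. f \<in> E \<Longrightarrow> f = (\<lambda>x. \<Sum>i<d. dot_on S f (e i) * e i x)"
proof -
  define P where "P d \<longleftrightarrow> (\<exists>e. orthonormal_on S d e \<and> (\<forall>i<d. e i \<in> E))" for d
  define d where "d = (GREATEST d. P d)"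
  have bound: "d \<le> card S" if "P d" for d
    using that orthonormal_length_le_card[OF fin] by (auto simp: P_def)
  have "P 0" by (simp add: P_def orthonormal_on_def)
  then have "P d" unfolding d_def using bound by (rule GreatestI_nat)
  then obtain e where on: "orthonormal_on S d e" and eE: "\<And>i. i < d \<Longrightarrow> e i \<in> E"
    by (auto simp: P_def)
  have max: "k \<le> d" if "P k" for k
    unfolding d_def using that bound by (rule Greatest_le_nat)
  have "f = (\<lambda>x. \<Sum>i<d. dot_on S f (e i) * e i x)" if f: "f \<in> E" for f
  proof (rule ccontr)
    define h where "h = (\<lambda>x. \<Sum>i<d. dot_on S f (e i) * e i x)"
    define r where "r = (\<lambda>x. f x - h x)"
    assume "f \<noteq> (\<lambda>x. \<Sum>i<d. dot_on S f (e i) * e i x)"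
    then obtain x where x: "r x \<noteq> 0" by (auto simp: r_def h_def)
    have hE: "h \<in> E" unfolding h_def using E eE by (rule function_subspace_sum)
    then have "(\<lambda>x. 1 * f x + (-1) * h x) \<in> E"
      using function_subspace_lincomb[OF E] f by blast
    then have rE: "r \<in> E" by (simp add: r_def)
    then have "x \<in> S" using x E by (auto simp: function_subspace_def)
    then have pos: "dot_on S r r > 0"
      using x dot_on_eq_0_iff[OF fin, of r] dot_on_nonneg[of S r] by force
    define c where "c = 1 / sqrt (dot_on S r r)"
    define u where "u = (\<lambda>x. c * r x + 0 * r x)"
    have uE: "u \<in> E" unfolding u_def using E rE rE by (rule function_subspace_lincomb)
    have ur: "dot_on S u g = c * dot_on S r g" for g
      by (simp add: u_def dot_on_lincomb_left del: mult_zero_left)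
    have "dot_on S u u = c * (c * dot_on S r r)"
      by (metis ur dot_on_commute)
    then have uu: "dot_on S u u = 1" using pos by (simp add: c_def)
    have ue: "dot_on S u (e j) = 0" if "j < d" for j
      using orthonormal_residual[OF on that, of f] by (simp add: ur r_def h_def)
    then have eu: "dot_on S (e j) u = 0" if "j < d" for j
      using that by (metis dot_on_commute)
    have "orthonormal_on S (Suc d) (e(d := u))"
      unfolding orthonormal_on_def
    proof (intro allI impI)
      fix i j assume "i < Suc d" "j < Suc d"
      then consider "i < d" "j < d" | "i < d" "j = d" | "i = d" "j < d" | "i = d" "j = d"
        by linarith
      then show "dot_on S ((e(d := u)) i) ((e(d := u)) j) = (if i = j then 1 else 0)"
        using on uu ue eu
        by cases (simp_all add: orthonormal_on_def)
    qed
    moreover have "\<forall>i<Suc d. (e(d := u)) i \<in> E" using eE uE by (simp add: less_Suc_eq)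
    ultimately have "P (Suc d)" unfolding P_def by blast
    then show False using max by fastforce
  qed
  with on eE show ?thesis by (rule that)
qed

section \<open>The largest singular value orthogonal to the constants\<close>

text \<open>The unit sphere of the functions with sum zero is a closed subset of a product of compact
intervals, hence compact in the product topology by Tychonoff's theorem, and the quadratic
form \<open>f \<mapsto> \<parallel>K f\<parallel>\<^sup>2\<close> depends on finitely many coordinates only. So it attains its maximum there,
and homogeneity extends the bound from unit vectors to all \<open>f\<close>.\<close>

lemma Rayleigh_quotient_max:
  fixes K :: "'a \<Rightarrow> 'a \<Rightarrow> real" and S :: "'a set"
  defines "W \<equiv> {f. (\<forall>x. x \<notin> S \<longrightarrow> f x = 0) \<and> sum f S = 0}"
  assumes fin: "finite S" and w: "w \<in> W" "dot_on S w w \<noteq> 0"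
  obtains v where "v \<in> W" "dot_on S v v = 1"
    "\<And>f. f \<in> W \<Longrightarrow>
      (\<Sum>x\<in>S. (dot_on S (K x) f)\<^sup>2) \<le> (\<Sum>x\<in>S. (dot_on S (K x) v)\<^sup>2) * dot_on S f f"
proof -
  define Q where "Q f = (\<Sum>x\<in>S. (dot_on S (K x) f)\<^sup>2)" for f :: "'a \<Rightarrow> real"
  define U where "U = {f \<in> W. dot_on S f f = 1}"
  define Box :: "('a \<Rightarrow> real) set" where "Box = (\<Pi>\<^sub>E x\<in>UNIV. if x \<in> S then {-1..1} else {0})"
  have coord: "continuous_on UNIV (\<lambda>f :: 'a \<Rightarrow> real. f x)" for x
    by (rule continuous_on_product_coordinates)
  have Qcont: "continuous_on UNIV Q"
    unfolding Q_def dot_on_def by (intro continuous_intros coord)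
  have "compact Box"
    using compactin_PiE[of "\<lambda>_. euclidean" UNIV "\<lambda>x. if x \<in> S then {-1..1::real} else {0}"]
    by (simp add: Box_def euclidean_product_topology)
  moreover have "closed U"
  proof -
    have "U = (\<Inter>x\<in>-S. {f. f x = 0}) \<inter> {f. sum f S = 0} \<inter> {f. dot_on S f f = 1}"
      by (auto simp: U_def W_def)
    moreover have "closed {f :: 'a \<Rightarrow> real. f x = 0}" for x
      by (intro closed_Collect_eq coord continuous_intros)
    moreover have "closed {f :: 'a \<Rightarrow> real. sum f S = 0}"
      by (intro closed_Collect_eq coord continuous_intros)
    moreover have "closed {f :: 'a \<Rightarrow> real. dot_on S f f = 1}"
      unfolding dot_on_def by (intro closed_Collect_eq coord continuous_intros)
    ultimately show ?thesis by auto
  qed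
  moreover have "U \<subseteq> Box"
  proof
    fix f assume f: "f \<in> U"
    have "f x \<in> {-1..1}" if "x \<in> S" for x
    proof -
      have "f x * f x \<le> dot_on S f f"
        unfolding dot_on_def using that fin by (intro member_le_sum) auto
      then have "(f x)\<^sup>2 \<le> 1" using f by (simp add: U_def power2_eq_square)
      then show ?thesis by (simp add: abs_square_le_1 abs_le_iff)
    qed
    then show "f \<in> Box" using f by (auto simp: Box_def U_def W_def)
  qed
  ultimately have "compact U" using closed_Int_compact[of U Box] by (simp add: Int_absorb2)
  have normalise: "(\<lambda>x. f x / sqrt (dot_on S f f)) \<in> U" if "f \<in> W" "dot_on S f f \<noteq> 0" for f
  proof -
    have "dot_on S f f > 0" using that dot_on_nonneg[of S f] by simp
    then have "dot_on S (\<lambda>x. f x / sqrt (dot_on S f f)) (\<lambda>x. f x / sqrt (dot_on S f f)) = 1"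
      by (simp add: dot_on_def flip: sum_divide_distrib)
    then show ?thesis using that by (auto simp: U_def W_def simp flip: sum_divide_distrib)
  qed
  have "U \<noteq> {}" using normalise[OF w] by auto
  then obtain v where v: "v \<in> U" and max: "\<And>f. f \<in> U \<Longrightarrow> Q f \<le> Q v"
    using continuous_attains_sup[OF \<open>compact U\<close>] Qcont continuous_on_subset by blast
  have "Q f \<le> Q v * dot_on S f f" if f: "f \<in> W" for f
  proof (cases "dot_on S f f = 0")
    case True
    then have "\<forall>x\<in>S. f x = 0" using fin by (simp add: dot_on_eq_0_iff)
    then have "Q f = 0" by (simp add: Q_def dot_on_def)
    with True show ?thesis by simp
  next
    case False
    then have pos: "dot_on S f f > 0" using dot_on_nonneg[of S f] by simp
    have "dot_on S g (\<lambda>x. f x / c) = dot_on S g f / c" for g c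
      by (simp add: dot_on_def sum_divide_distrib)
    then have "Q (\<lambda>x. f x / sqrt (dot_on S f f)) = Q f / dot_on S f f"
      using pos by (simp add: Q_def power_divide flip: sum_divide_distrib)
    with max[OF normalise[OF f False]] pos show ?thesis by (simp add: field_simps)
  qed
  with v show ?thesis using that by (auto simp: U_def Q_def)
qed

section \<open>Invariant subspaces and representations\<close>

definition translate :: "('a, 'b) monoid_scheme \<Rightarrow> 'a \<Rightarrow> ('a \<Rightarrow> real) \<Rightarrow> 'a \<Rightarrow> real" where
  "translate G g f = (\<lambda>y. if y \<in> carrier G then f (inv\<^bsub>G\<^esub> g \<otimes>\<^bsub>G\<^esub> y) else 0)"

lemma translate_sum:
  "translate G g (\<lambda>x. \<Sum>i<(d::nat). c i * e i x) = (\<lambda>x. \<Sum>i<d. c i * translate G g (e i) x)"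
  by (auto simp: translate_def)

context group
begin

lemma translate_translate:
  assumes "g \<in> carrier G" "h \<in> carrier G"
  shows "translate G g (translate G h f) = translate G (g \<otimes> h) f"
  using assms by (auto simp: translate_def inv_mult_group m_assoc)

lemma translate_one:
  assumes "\<And>x. x \<notin> carrier G \<Longrightarrow> f x = 0"
  shows "translate G \<one> f = f"
  using assms by (auto simp: translate_def)

lemma sum_mult_left:
  assumes "g \<in> carrier G"
  shows "(\<Sum>y\<in>carrier G. F (g \<otimes> y)) = (\<Sum>y\<in>carrier G. F y)"
  using assms
  by (intro sum.reindex_bij_witness[where i = "\<lambda>y. inv g \<otimes> y" and j = "\<lambda>y. g \<otimes> y"])
     (simp_all flip: m_assoc)

lemma sum_mult_right:
  assumes "g \<in> carrier G"
  shows "(\<Sum>y\<in>carrier G. F (y \<otimes> g)) = (\<Sum>y\<in>carrier G. F y)"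
  using assms
  by (intro sum.reindex_bij_witness[where i = "\<lambda>y. y \<otimes> inv g" and j = "\<lambda>y. y \<otimes> g"])
     (simp_all add: m_assoc)

lemma sum_translate:
  assumes "g \<in> carrier G"
  shows "sum (translate G g f) (carrier G) = sum f (carrier G)"
  using sum_mult_left[of "inv g" f] assms by (simp add: translate_def cong: sum.cong)

lemma dot_on_translate:
  assumes "g \<in> carrier G"
  shows "dot_on (carrier G) (translate G g f) (translate G g h) = dot_on (carrier G) f h"
  using sum_mult_left[of "inv g" "\<lambda>y. f y * h y"] assms
  by (simp add: dot_on_def translate_def cong: sum.cong)

text \<open>In an orthonormal basis \<open>e\<close> of the invariant subspace, translation by \<open>g\<close> has the matrix entries
\<open>\<langle>e\<^sub>i, g e\<^sub>j\<rangle>\<close>, and expanding \<open>h e\<^sub>j\<close> in the basis turns composition of translations into matrix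
multiplication. If every matrix were the identity, each basis vector would be translation
invariant, hence constant on the group, hence zero there.\<close>

lemma invariant_subspace_representation:
  fixes E :: "('a \<Rightarrow> real) set" and e :: "nat \<Rightarrow> 'a \<Rightarrow> real"
  assumes fin: "finite (carrier G)"
    and E: "function_subspace (carrier G) E"
    and inv: "\<And>f g. f \<in> E \<Longrightarrow> g \<in> carrier G \<Longrightarrow> translate G g f \<in> E"
    and nonconst: "\<And>f c. f \<in> E \<Longrightarrow> (\<And>x. x \<in> carrier G \<Longrightarrow> f x = c) \<Longrightarrow> c = 0"
    and on: "orthonormal_on (carrier G) d e" and eE: "\<And>i. i < d \<Longrightarrow> e i \<in> E"
    and span: "\<And>f. f \<in> E \<Longrightarrow> f = (\<lambda>x. \<Sum>i<d. dot_on (carrier G) f (e i) * e i x)"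
    and d: "d > 0"
  shows "\<exists>\<rho>. nontrivial_representation G d \<rho>"
proof -
  define \<rho> where "\<rho> g = mat d d (\<lambda>(i, j).
    complex_of_real (dot_on (carrier G) (e i) (translate G g (e j))))" for g
  have mult: "\<rho> (g \<otimes> h) = \<rho> g * \<rho> h" if g: "g \<in> carrier G" and h: "h \<in> carrier G" for g h
  proof (rule eq_matI)
    fix i j assume "i < dim_row (\<rho> g * \<rho> h)" "j < dim_col (\<rho> g * \<rho> h)"
    then have ij: "i < d" "j < d" by (simp_all add: \<rho>_def)
    have "translate G g (translate G h (e j)) = translate G g
        (\<lambda>x. \<Sum>k<d. dot_on (carrier G) (translate G h (e j)) (e k) * e k x)"
      by (rule arg_cong[OF span[OF inv[OF eE[OF ij(2)] h]]])
    then have "translate G (g \<otimes> h) (e j)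
        = (\<lambda>x. \<Sum>k<d. dot_on (carrier G) (translate G h (e j)) (e k) * translate G g (e k) x)"
      by (simp only: translate_sum translate_translate[OF g h])
    then have "dot_on (carrier G) (e i) (translate G (g \<otimes> h) (e j))
        = (\<Sum>k<d. dot_on (carrier G) (translate G h (e j)) (e k)
                * dot_on (carrier G) (e i) (translate G g (e k)))"
      by (simp only: dot_on_sum_right)
    also have "\<dots> = (\<Sum>k<d. dot_on (carrier G) (e i) (translate G g (e k))
                * dot_on (carrier G) (e k) (translate G h (e j)))"
      by (simp only: mult.commute dot_on_commute[of _ "translate G h (e j)"])
    finally have "dot_on (carrier G) (e i) (translate G (g \<otimes> h) (e j)) = \<dots>" .
    then show "\<rho> (g \<otimes> h) $$ (i, j) = (\<rho> g * \<rho> h) $$ (i, j)"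
      using ij by (simp add: \<rho>_def scalar_prod_def lessThan_atLeast0)
  qed (simp_all add: \<rho>_def)
  have one: "\<rho> \<one> = 1\<^sub>m d"
  proof (rule eq_matI)
    fix i j assume "i < dim_row (1\<^sub>m d :: complex mat)" "j < dim_col (1\<^sub>m d :: complex mat)"
    moreover from this have "translate G \<one> (e j) = e j"
      using E eE by (intro translate_one) (auto simp: function_subspace_def)
    ultimately show "\<rho> \<one> $$ (i, j) = 1\<^sub>m d $$ (i, j)"
      using on by (simp add: \<rho>_def orthonormal_on_def)
  qed (simp_all add: \<rho>_def)
  have "\<rho> g \<in> Units (ring_mat TYPE(complex) d ())" if g: "g \<in> carrier G" for g
  proof -
    have "\<rho> g * \<rho> (inv g) = 1\<^sub>m d" "\<rho> (inv g) * \<rho> g = 1\<^sub>m d"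
      using g by (simp_all add: one flip: mult)
    moreover have "\<rho> h \<in> carrier_mat d d" for h by (simp add: \<rho>_def)
    ultimately show ?thesis unfolding Units_def ring_mat_def by auto
  qed
  then have rep: "representation G d \<rho>"
    using mult unfolding representation_def complex_GL_def hom_def units_of_def
    by (auto simp: ring_mat_def)
  have "\<exists>g\<in>carrier G. \<rho> g \<noteq> 1\<^sub>m d"
  proof (rule ccontr)
    assume "\<not> ?thesis"
    then have triv: "\<rho> g = 1\<^sub>m d" if "g \<in> carrier G" for g using that by blast
    have fixed: "translate G g (e 0) = e 0" if g: "g \<in> carrier G" for g
    proof -
      have coeff: "dot_on (carrier G) (translate G g (e 0)) (e i) = (if i = 0 then 1 else 0)"
        if "i < d" for i
      proof -
        have "complex_of_real (dot_on (carrier G) (e i) (translate G g (e 0))) = \<rho> g $$ (i, 0)"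
          using that d by (simp add: \<rho>_def)
        also have "\<dots> = (if i = 0 then 1 else 0)" using that d triv[OF g] by simp
        finally show ?thesis by (simp add: dot_on_commute split: if_splits)
      qed
      have "translate G g (e 0)
          = (\<lambda>x. \<Sum>i<d. dot_on (carrier G) (translate G g (e 0)) (e i) * e i x)"
        by (rule span[OF inv[OF eE[OF d] g]])
      also have "\<dots> = (\<lambda>x. \<Sum>i<d. if i = 0 then e i x else 0)"
        by (intro ext sum.cong) (simp_all add: coeff)
      also have "\<dots> = e 0" using d by simp
      finally show ?thesis .
    qed
    have const: "e 0 x = e 0 \<one>" if x: "x \<in> carrier G" for x
      using fun_cong[OF fixed[OF x], of x] x by (simp add: translate_def)
    then have "e 0 \<one> = 0" by (rule nonconst[OF eE[OF d]])
    with const have "dot_on (carrier G) (e 0) (e 0) = 0" by (simp add: dot_on_def)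
    with on d show False by (simp add: orthonormal_on_def)
  qed
  with rep show ?thesis unfolding nontrivial_representation_def by blast
qed

section \<open>The spectral bound for product graphs\<close>

text \<open>Let \<open>K\<close> be the adjacency matrix of the bipartite graph in which \<open>x\<close> and \<open>y\<close> are joined when
\<open>x \<otimes> y \<in> A\<close>, and let \<open>\<lambda> = Q v\<close> be the maximum of \<open>\<parallel>K f\<parallel>\<^sup>2 / \<parallel>f\<parallel>\<^sup>2\<close> over functions with sum zero. The set \<open>E\<close>
of functions attaining this maximum, with zero included, is the top eigenspace, and translations preserve it: translating \<open>f\<close>
by \<open>g\<close> only permutes the rows, \<open>x\<close> going to \<open>x \<otimes> g\<close>. It contains no nonzero constant, so its dimension
\<open>d\<close> is that of a nontrivial representation and \<open>d \<ge> \<delta>\<close>. On the other hand, the \<open>d\<close> basis vectors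
contribute \<open>d \<lambda>\<close> to the squared Hilbert--Schmidt norm of \<open>K\<close>, which equals \<open>n |A|\<close> because each of the
\<open>n\<close> rows has \<open>|A|\<close> ones. Hence \<open>\<lambda> \<le> n |A| / \<delta>\<close>.\<close>

lemma product_graph_norm_bound:
  assumes fin: "finite (carrier G)" and A: "A \<subseteq> carrier G" and \<delta>: "\<delta> > 0"
    and quasirandom: "\<And>d \<rho>. nontrivial_representation G d \<rho> \<Longrightarrow> \<delta> \<le> real d"
    and supp: "\<And>x. x \<notin> carrier G \<Longrightarrow> f x = 0" and sum0: "sum f (carrier G) = 0"
  defines "K \<equiv> \<lambda>x y. if x \<otimes> y \<in> A then 1 else 0 :: real"
  shows "(\<Sum>x\<in>carrier G. (dot_on (carrier G) (K x) f)\<^sup>2)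
    \<le> real (order G) * real (card A) / \<delta> * dot_on (carrier G) f f"
proof (cases "dot_on (carrier G) f f = 0")
  case True
  then have "\<forall>x\<in>carrier G. f x = 0" using fin by (simp add: dot_on_eq_0_iff)
  then show ?thesis by (simp add: dot_on_def)
next
  case False
  define S where "S = carrier G"
  define W where "W = {f :: 'a \<Rightarrow> real. (\<forall>x. x \<notin> S \<longrightarrow> f x = 0) \<and> sum f S = 0}"
  define Q where "Q f = (\<Sum>x\<in>S. (dot_on S (K x) f)\<^sup>2)" for f
  have finS: "finite S" using fin by (simp add: S_def)
  have fW: "f \<in> W" using supp sum0 by (simp add: W_def S_def)
  obtain v where v: "v \<in> W" "dot_on S v v = 1"
    and max: "\<And>f. f \<in> W \<Longrightarrow> Q f \<le> Q v * dot_on S f f"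
  proof (rule Rayleigh_quotient_max[of S f K])
    show "finite S" "f \<in> {f. (\<forall>x. x \<notin> S \<longrightarrow> f x = 0) \<and> sum f S = 0}" "dot_on S f f \<noteq> 0"
      using fin fW False by (simp_all add: S_def W_def)
  next
    fix v
    assume "v \<in> {f. (\<forall>x. x \<notin> S \<longrightarrow> f x = 0) \<and> sum f S = 0}" "dot_on S v v = 1"
      and "\<And>f. f \<in> {f. (\<forall>x. x \<notin> S \<longrightarrow> f x = 0) \<and> sum f S = 0} \<Longrightarrow>
        (\<Sum>x\<in>S. (dot_on S (K x) f)\<^sup>2) \<le> (\<Sum>x\<in>S. (dot_on S (K x) v)\<^sup>2) * dot_on S f f"
    then show thesis unfolding W_def[symmetric] Q_def[symmetric] by (rule that)
  qed
  define E where "E = {f \<in> W. Q f = Q v * dot_on S f f}"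
  \<comment> \<open>Where the nonnegative form \<open>Q v * \<parallel>f\<parallel>\<^sup>2 - Q f\<close> vanishes at \<open>f\<close> and at \<open>g\<close>, the parallelogram
    law makes its values at \<open>a f + b g\<close> and \<open>a f - b g\<close> add up to zero, so both are zero.
    Thus \<open>E\<close> is a subspace without any appeal to eigenvectors.\<close>
  have E: "function_subspace S E"
    unfolding function_subspace_def
  proof (intro conjI ballI allI impI)
    show "E \<noteq> {}" using v by (auto simp: E_def)
  next
    fix f x assume "f \<in> E" "x \<notin> S"
    then show "f x = 0" by (simp add: E_def W_def)
  next
    fix f g a b assume f: "f \<in> E" and g: "g \<in> E"
    define u where "u c = (\<lambda>x. a * f x + c * g x)" for c
    have uW: "u c \<in> W" for c
      using f g by (simp add: u_def E_def W_def sum.distrib flip: sum_distrib_left)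
    have expand: "dot_on S h (u c) = a * dot_on S h f + c * dot_on S h g" for h c
      by (simp add: u_def dot_on_lincomb_right)
    have "dot_on S (u c) (u c)
        = a\<^sup>2 * dot_on S f f + 2 * a * c * dot_on S f g + c\<^sup>2 * dot_on S g g" for c
      unfolding expand by (simp add: u_def dot_on_lincomb_left dot_on_commute[of S g f]
        power2_eq_square algebra_simps)
    then have par_dot: "dot_on S (u b) (u b) + dot_on S (u (-b)) (u (-b))
        = 2 * a\<^sup>2 * dot_on S f f + 2 * b\<^sup>2 * dot_on S g g"
      by simp
    have "Q (u b) + Q (u (-b)) = 2 * a\<^sup>2 * Q f + 2 * b\<^sup>2 * Q g"
      unfolding Q_def sum_distrib_left sum.distrib[symmetric] expand
      by (rule sum.cong) (simp_all add: power2_eq_square algebra_simps)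
    also have "\<dots> = Q v * (dot_on S (u b) (u b) + dot_on S (u (-b)) (u (-b)))"
      using f g unfolding par_dot by (simp add: E_def algebra_simps)
    finally have "Q (u b) + Q (u (-b))
        = Q v * dot_on S (u b) (u b) + Q v * dot_on S (u (-b)) (u (-b))"
      by (simp add: algebra_simps)
    with max[OF uW[of b]] max[OF uW[of "-b"]] have "Q (u b) = Q v * dot_on S (u b) (u b)"
      by linarith
    then show "(\<lambda>x. a * f x + b * g x) \<in> E" using uW[of b] by (simp add: E_def u_def)
  qed
  obtain d e where on: "orthonormal_on S d e" and eE: "\<And>i. i < d \<Longrightarrow> e i \<in> E"
    and span: "\<And>f. f \<in> E \<Longrightarrow> f = (\<lambda>x. \<Sum>i<d. dot_on S f (e i) * e i x)"
    using that by (rule orthonormal_basis_exists[OF finS E])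
  have "d > 0"
  proof (rule ccontr)
    assume "\<not> d > 0"
    with span[of v] v have "v = (\<lambda>x. 0)" by (simp add: E_def)
    with v show False by (simp add: dot_on_def)
  qed
  have invariant: "translate G g f \<in> E" if f: "f \<in> E" and g: "g \<in> carrier G" for f g
  proof -
    have "dot_on S (K x) (translate G g f) = dot_on S (K (x \<otimes> g)) f" if x: "x \<in> S" for x
    proof -
      have "x \<otimes> g \<otimes> (inv g \<otimes> y) = x \<otimes> y" if y: "y \<in> S" for y
      proof -
        have "g \<otimes> (inv g \<otimes> y) = y" using g y by (simp add: S_def flip: m_assoc)
        then show ?thesis using g x y by (simp add: S_def m_assoc)
      qed
      then have "dot_on S (K x) (translate G g f)
          = (\<Sum>y\<in>S. K (x \<otimes> g) (inv g \<otimes> y) * f (inv g \<otimes> y))"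
        unfolding dot_on_def by (intro sum.cong) (simp_all add: translate_def S_def K_def)
      then show ?thesis
        using sum_mult_left[of "inv g" "\<lambda>y. K (x \<otimes> g) y * f y"] g
        by (simp add: dot_on_def S_def)
    qed
    then have "Q (translate G g f) = (\<Sum>x\<in>S. (dot_on S (K (x \<otimes> g)) f)\<^sup>2)"
      by (simp add: Q_def)
    also have "\<dots> = Q f"
      using sum_mult_right[OF g, of "\<lambda>x. (dot_on S (K x) f)\<^sup>2"] by (simp add: Q_def S_def)
    finally have "Q (translate G g f) = Q f" .
    moreover have "translate G g f \<in> W"
      using f g sum_translate[OF g, of f] by (simp add: E_def W_def S_def) (simp add: translate_def)
    ultimately show ?thesis using f dot_on_translate[OF g] by (simp add: E_def S_def)
  qed
  have "c = 0" if "f \<in> E" "\<And>x. x \<in> carrier G \<Longrightarrow> f x = c" for f c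
  proof -
    have "real (card S) * c = sum f S" using that(2) by (simp add: S_def)
    also have "\<dots> = 0" using that(1) by (simp add: E_def W_def)
    finally show ?thesis using fin by (auto simp: S_def)
  qed
  then have "\<exists>\<rho>. nontrivial_representation G d \<rho>"
    using invariant_subspace_representation[of E d e] fin E invariant on eE span \<open>d > 0\<close>
    unfolding S_def by blast
  then have "\<delta> \<le> real d" using quasirandom by blast
  have Q_nonneg: "Q f \<ge> 0" for f by (simp add: Q_def sum_nonneg)
  \<comment> \<open>The map \<open>y \<mapsto> x \<otimes> y\<close> is a bijection of the group, so row \<open>x\<close> has as many ones as \<open>A\<close> has elements.\<close>
  have row: "dot_on S (K x) (K x) = real (card A)" if x: "x \<in> S" for x
  proof -
    have "dot_on S (K x) (K x) = (\<Sum>y\<in>S. if x \<otimes> y \<in> A then 1 else 0)"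
      unfolding dot_on_def by (rule sum.cong) (auto simp: K_def)
    also have "\<dots> = (\<Sum>y\<in>S. if y \<in> A then 1 else 0)"
      using sum_mult_left[of x "\<lambda>y. if y \<in> A then 1 else 0 :: real"] x by (simp add: S_def)
    also have "\<dots> = real (card A)"
      using fin A by (simp add: S_def sum.If_cases Int_absorb1)
    finally show ?thesis .
  qed
  have "\<delta> * Q v \<le> real d * Q v" using \<open>\<delta> \<le> real d\<close> Q_nonneg by (rule mult_right_mono)
  also have "\<dots> = (\<Sum>i<d. Q (e i))"
  proof -
    have "Q (e i) = Q v" if "i < d" for i
      using eE[OF that] on that by (simp add: E_def orthonormal_on_def)
    then show ?thesis by simp
  qed
  also have "\<dots> = (\<Sum>x\<in>S. \<Sum>i<d. (dot_on S (K x) (e i))\<^sup>2)"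
    unfolding Q_def by (rule sum.swap)
  also have "\<dots> \<le> (\<Sum>x\<in>S. dot_on S (K x) (K x))"
    by (intro sum_mono Bessel_inequality on)
  also have "\<dots> = real (order G) * real (card A)"
    using row by (simp add: S_def order_def)
  finally have "Q v \<le> real (order G) * real (card A) / \<delta>" using \<delta> by (simp add: field_simps)
  then have "Q v * dot_on S f f \<le> real (order G) * real (card A) / \<delta> * dot_on S f f"
    using dot_on_nonneg by (rule mult_right_mono)
  with max[OF fW] show ?thesis by (simp add: Q_def S_def)
qed

end

section \<open>Typical vertices and the greedy choice\<close>

lemma set_density_nonneg: "set_density G A \<ge> 0"
  by (simp add: set_density_def)

context group
begin

text \<open>A random \<open>x\<close> sees \<open>|A| |Y| / n\<close> elements \<open>y \<in> Y\<close> with \<open>x \<otimes> y \<in> A\<close> on average. The deviations from this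
average are the values of \<open>K f\<close>, where \<open>f\<close> is the indicator function of \<open>Y\<close> minus its mean, so the
spectral bound controls their sum of squares. The claim is Chebyshev's inequality for
this second moment.\<close>

lemma few_poor_vertices:
  assumes fin: "finite (carrier G)" and A: "A \<subseteq> carrier G" and Y: "Y \<subseteq> carrier G"
    and \<delta>: "\<delta> > 0"
    and quasirandom: "\<And>d \<rho>. nontrivial_representation G d \<rho> \<Longrightarrow> \<delta> \<le> real d"
    and t: "t > 0" and pos: "set_density G A > 0" "set_density G Y > 0"
  shows "set_density G {x \<in> carrier G. set_density G {y \<in> Y. x \<otimes> y \<in> A}
            \<le> (1 - t) * (set_density G A * set_density G Y)}
         \<le> 1 / (t\<^sup>2 * (set_density G A * set_density G Y) * \<delta>)"
proof -
  define S where "S = carrier G"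
  define n where "n = real (order G)"
  define a where "a = real (card A)"
  define b where "b = real (card Y)"
  have finS: "finite S" and finY: "finite Y" using fin Y by (auto simp: S_def intro: finite_subset)
  have n: "n > 0" using fin by (simp add: n_def order_gt_0_iff_finite)
  have cardS: "real (card S) = n" by (simp add: S_def n_def order_def)
  have ab: "a > 0" "b > 0"
    using pos n by (simp_all add: set_density_def a_def b_def n_def zero_less_divide_iff)
  define K where "K x y = (if x \<otimes> y \<in> A then 1 else 0 :: real)" for x y
  define f where "f y = (if y \<in> S then (if y \<in> Y then 1 else 0) - b / n else 0)" for y
  define N where "N x = real (card {y \<in> Y. x \<otimes> y \<in> A})" for x
  have sum_indicator: "(\<Sum>y\<in>S. if y \<in> Z then 1 else 0) = real (card Z)" if "Z \<subseteq> S" for Z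
    using finS that by (simp add: sum.If_cases Int_absorb1)
  have YS: "Y \<subseteq> S" using Y by (simp add: S_def)
  have sum0: "sum f S = 0"
    using n by (simp add: f_def sum_subtractf sum_indicator[OF YS] cardS b_def)
  have "dot_on S f f = (\<Sum>y\<in>S. (1 - 2 * (b / n)) * (if y \<in> Y then 1 else 0) + (b / n)\<^sup>2)"
    unfolding dot_on_def by (rule sum.cong) (auto simp: f_def power2_eq_square algebra_simps)
  also have "\<dots> = b - b * (b / n)"
    using n by (simp add: sum.distrib sum_indicator[OF YS] cardS flip: sum_distrib_left b_def)
      (simp add: power2_eq_square field_simps)
  finally have norm: "dot_on S f f \<le> b" using ab n by simp
  have dev: "dot_on S (K x) f = N x - a * b / n" if x: "x \<in> S" for x
  proof -
    have "(\<Sum>y\<in>S. K x y) = (\<Sum>y\<in>S. if y \<in> A then 1 else 0)"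
      using sum_mult_left[of x "\<lambda>y. if y \<in> A then 1 else 0 :: real"] x by (simp add: S_def K_def)
    also have "\<dots> = a" using A by (subst sum_indicator) (simp_all add: a_def S_def)
    finally have row: "(\<Sum>y\<in>S. K x y) = a" .
    have "(\<Sum>y\<in>S. if y \<in> {y \<in> Y. x \<otimes> y \<in> A} then 1 else 0) = N x"
      unfolding N_def using YS by (intro sum_indicator) auto
    moreover have "dot_on S (K x) f
        = (\<Sum>y\<in>S. (if y \<in> {y \<in> Y. x \<otimes> y \<in> A} then 1 else 0) - b / n * K x y)"
      unfolding dot_on_def by (rule sum.cong) (auto simp: f_def K_def)
    moreover have "(\<Sum>y\<in>S. b / n * K x y) = a * b / n"
      by (simp only: row sum_distrib_left[symmetric]) simp
    ultimately show ?thesis by (simp only: sum_subtractf)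
  qed
  define Bad where "Bad = {x \<in> S. N x \<le> (1 - t) * (a * b / n)}"
  have "real (card Bad) * (t * (a * b / n))\<^sup>2 = (\<Sum>x\<in>Bad. (t * (a * b / n))\<^sup>2)" by simp
  also have "\<dots> \<le> (\<Sum>x\<in>Bad. (dot_on S (K x) f)\<^sup>2)"
  proof (rule sum_mono)
    fix x assume "x \<in> Bad"
    then have "x \<in> S" "N x \<le> a * b / n - t * (a * b / n)"
      by (simp_all add: Bad_def left_diff_distrib diff_divide_distrib)
    then have "t * (a * b / n) \<le> - dot_on S (K x) f"
      by (simp add: dev)
    moreover have "0 \<le> t * (a * b / n)" using t ab n by simp
    ultimately have "(t * (a * b / n))\<^sup>2 \<le> (- dot_on S (K x) f)\<^sup>2" by (intro power_mono)
    then show "(t * (a * b / n))\<^sup>2 \<le> (dot_on S (K x) f)\<^sup>2" by simp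
  qed
  also have "\<dots> \<le> (\<Sum>x\<in>S. (dot_on S (K x) f)\<^sup>2)"
    using finS by (intro sum_mono2) (auto simp: Bad_def)
  also have "\<dots> \<le> n * a / \<delta> * dot_on S f f"
    using product_graph_norm_bound[OF fin A \<delta> quasirandom, where f = f] sum0
    unfolding n_def a_def S_def K_def by (simp add: f_def S_def)
  also have "\<dots> \<le> n * a / \<delta> * b"
    using norm n ab \<delta> by (intro mult_left_mono) simp_all
  finally have "real (card Bad) * (t * (a * b / n))\<^sup>2 \<le> n * a / \<delta> * b" .
  then have "real (card Bad) / n \<le> 1 / (t\<^sup>2 * (a / n * (b / n)) * \<delta>)"
    using n ab t \<delta> by (simp add: field_simps power2_eq_square)
  moreover have "Bad = {x \<in> carrier G. set_density G {y \<in> Y. x \<otimes> y \<in> A}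
            \<le> (1 - t) * (set_density G A * set_density G Y)}"
    unfolding Bad_def S_def N_def set_density_def a_def[symmetric] b_def[symmetric] n_def[symmetric]
    using n by (intro Collect_cong) (simp add: field_simps)
  ultimately show ?thesis
    by (simp add: set_density_def n_def a_def b_def)
qed

text \<open>A union bound over \<open>j\<close>: the exceptional sets of the preceding lemma are together too small to
cover \<open>V\<close>.\<close>

lemma exists_rich_vertex:
  fixes Y A :: "'i \<Rightarrow> 'a set"
  assumes fin: "finite (carrier G)" and J: "finite J" and V: "V \<subseteq> carrier G"
    and A: "\<And>j. j \<in> J \<Longrightarrow> A j \<subseteq> carrier G" and Y: "\<And>j. j \<in> J \<Longrightarrow> Y j \<subseteq> carrier G"
    and \<delta>: "\<delta> > 0"
    and quasirandom: "\<And>d \<rho>. nontrivial_representation G d \<rho> \<Longrightarrow> \<delta> \<le> real d"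
    and t: "t > 0"
    and pos: "\<And>j. j \<in> J \<Longrightarrow> set_density G (A j) > 0" "\<And>j. j \<in> J \<Longrightarrow> set_density G (Y j) > 0"
    and small: "(\<Sum>j\<in>J. 1 / (t\<^sup>2 * (set_density G (A j) * set_density G (Y j)) * \<delta>))
                  < set_density G V"
  obtains x where "x \<in> V"
    "\<And>j. j \<in> J \<Longrightarrow> set_density G {y \<in> Y j. x \<otimes> y \<in> A j}
            > (1 - t) * (set_density G (A j) * set_density G (Y j))"
proof -
  define Bad where "Bad j = {x \<in> carrier G. set_density G {y \<in> Y j. x \<otimes> y \<in> A j}
            \<le> (1 - t) * (set_density G (A j) * set_density G (Y j))}" for j
  have "\<not> V \<subseteq> (\<Union>j\<in>J. Bad j)"
  proof
    assume cover: "V \<subseteq> (\<Union>j\<in>J. Bad j)"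
    have "finite (\<Union>j\<in>J. Bad j)" using fin J by (auto simp: Bad_def)
    then have "card V \<le> card (\<Union>j\<in>J. Bad j)" using cover by (rule card_mono)
    also have "\<dots> \<le> (\<Sum>j\<in>J. card (Bad j))" using J by (rule card_UN_le)
    finally have "real (card V) \<le> (\<Sum>j\<in>J. real (card (Bad j)))"
      by (simp flip: of_nat_sum)
    then have "set_density G V \<le> (\<Sum>j\<in>J. set_density G (Bad j))"
      by (simp add: set_density_def divide_right_mono flip: sum_divide_distrib)
    also have "\<dots> \<le> (\<Sum>j\<in>J. 1 / (t\<^sup>2 * (set_density G (A j) * set_density G (Y j)) * \<delta>))"
      unfolding Bad_def
      by (intro sum_mono few_poor_vertices[OF fin _ _ \<delta> quasirandom t]) (use A Y pos in auto)
    finally show False using small by simp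
  qed
  then obtain x where "x \<in> V" "\<And>j. j \<in> J \<Longrightarrow> x \<notin> Bad j" by blast
  with V show ?thesis by (intro that[of x]) (auto simp: Bad_def not_le)
qed

lemma density_product_pos_factors:
  assumes "density_product (\<lambda>k. set_density G (A k)) (\<lambda>k l. set_density G (B k l)) 1 j > 0"
  shows "set_density G (A 1) > 0" "set_density G (A j) > 0" "set_density G (B 1 j) > 0"
  using assms set_density_nonneg[of G "A 1"] set_density_nonneg[of G "A j"]
    set_density_nonneg[of G "B 1 j"]
  by (auto simp: density_product_def zero_less_mult_iff)

text \<open>The induction keeps the stronger conclusion \<open>x i \<in> A i\<close>. Let \<open>p j\<close> and \<open>q i j\<close> be the
densities of \<open>A j\<close> and \<open>B i j\<close>, and let \<open>t\<^sup>2 = m / f m\<close>. The step chooses the first element \<open>x\<close> in \<open>A 1\<close>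
and replaces each \<open>A j\<close> by the set of those \<open>y \<in> A j\<close> with \<open>x \<otimes> y \<in> B 1 j\<close>, whose density is at least
\<open>(1 - t) * q 1 j * p j\<close>. The factors \<open>q 1 i * q 1 j\<close> thus move from the edge part of the density
product into the vertex densities, and the new product is at least \<open>(1 - t)\<^sup>2\<close> times the old one;
this is why the density product has its particular form. The condition linking
\<open>f m\<close> and \<open>f (m - 1)\<close> absorbs the loss of \<open>(1 - t)\<^sup>2\<close>.\<close>

lemma exists_elements_with_prescribed_products:
  fixes f :: "nat \<Rightarrow> real" and A :: "nat \<Rightarrow> 'a set" and B :: "nat \<Rightarrow> nat \<Rightarrow> 'a set"
  assumes fin: "finite (carrier G)" and \<delta>: "\<delta> > 0"
    and quasirandom: "\<And>d \<rho>. nontrivial_representation G d \<rho> \<Longrightarrow> \<delta> \<le> real d"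
    and f_pos: "\<And>k. k \<ge> 2 \<Longrightarrow> f k > 0" and f_2: "f 2 > 1"
    and f_step: "\<And>k. k \<ge> 3 \<Longrightarrow> (1 - sqrt (real k / f k))\<^sup>2 * f k \<ge> f (k - 1)"
    and f_ge: "\<And>k. k \<ge> 3 \<Longrightarrow> f k \<ge> real k"
    and m: "m \<ge> 2"
    and A: "\<And>i. 1 \<le> i \<Longrightarrow> i \<le> m \<Longrightarrow> A i \<subseteq> carrier G"
    and B: "\<And>i j. 1 \<le> i \<Longrightarrow> i < j \<Longrightarrow> j \<le> m \<Longrightarrow> B i j \<subseteq> carrier G"
    and P: "\<And>i j. 1 \<le> i \<Longrightarrow> i < j \<Longrightarrow> j \<le> m \<Longrightarrow>
      density_product (\<lambda>k. set_density G (A k)) (\<lambda>k l. set_density G (B k l)) i j \<ge> f m / \<delta>"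
  shows "\<exists>x :: nat \<Rightarrow> 'a. (\<forall>i. 1 \<le> i \<and> i \<le> m \<longrightarrow> x i \<in> A i) \<and>
    (\<forall>i j. 1 \<le> i \<and> i < j \<and> j \<le> m \<longrightarrow> x i \<otimes> x j \<in> B i j)"
  using m A B P
proof (induction m arbitrary: A B rule: nat_induct_at_least)
  case base
  have P12: "set_density G (A 1) * set_density G (A 2) * set_density G (B 1 2) \<ge> f 2 / \<delta>"
    using base(3)[of 1 2] by (simp add: density_product_def)
  have P_pos: "f 2 / \<delta> > 0" using f_pos[of 2] \<delta> by simp
  have pos: "set_density G (A 1) > 0" "set_density G (A 2) > 0" "set_density G (B 1 2) > 0"
    using P12 P_pos by (intro density_product_pos_factors[of A B 2]; simp add: density_product_def)+
  have "1 / \<delta> < f 2 / \<delta>" using f_2 \<delta> by (simp add: divide_strict_right_mono)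
  also note P12
  finally have "1 / (set_density G (B 1 2) * set_density G (A 2) * \<delta>) < set_density G (A 1)"
    using pos \<delta> by (simp add: field_simps)
  (* With t = 1 an exceptional x is one that has no partner y in A 2 at all. *)
  then obtain x where x: "x \<in> A 1" and "set_density G {y \<in> A 2. x \<otimes> y \<in> B 1 2} > 0"
    using exists_rich_vertex[OF fin, of "{2}" "A 1" "B 1" A \<delta> 1] base(1,2) pos \<delta> quasirandom
    by auto
  then obtain y where y: "y \<in> A 2" "x \<otimes> y \<in> B 1 2"
    by (metis (no_types, lifting) set_density_def card.empty div_0 empty_Collect_eq less_irrefl of_nat_0)
  show ?case
  proof (intro exI[of _ "\<lambda>i. if i = 1 then x else y"] conjI allI impI)
    fix i :: nat assume "1 \<le> i \<and> i \<le> 2"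
    then have "i = 1 \<or> i = 2" by auto
    then show "(if i = 1 then x else y) \<in> A i" using x y by auto
  next
    fix i j :: nat assume "1 \<le> i \<and> i < j \<and> j \<le> 2"
    then have "i = 1" "j = 2" by auto
    then show "(if i = 1 then x else y) \<otimes> (if j = 1 then x else y) \<in> B i j" using y by simp
  qed
next
  case (Suc m)
  define M where "M = Suc m"
  have M: "M \<ge> 3" using Suc.hyps by (simp add: M_def)
  define p where "p k = set_density G (A k)" for k
  define q where "q k l = set_density G (B k l)" for k l
  \<comment> \<open>For each of the \<open>M - 1\<close> remaining indices the exceptional set has density at most
    \<open>p 1 / (t\<^sup>2 * f M)\<close>; this choice of \<open>t\<close> makes it \<open>p 1 / M\<close>, so that \<open>A 1\<close> is not covered.\<close>
  define t where "t = sqrt (real M / f M)"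
  have fM: "f M > 0" "f M \<ge> real M" using f_pos f_ge M by simp_all
  have t_pos: "t > 0" and t_le: "t \<le> 1" and t_sq: "t\<^sup>2 = real M / f M"
    using fM M by (simp_all add: t_def)
  have P: "density_product p q i j \<ge> f M / \<delta>" if "1 \<le> i" "i < j" "j \<le> M" for i j
    using Suc.prems(3)[of i j] that by (simp add: M_def p_def[abs_def] q_def[abs_def])
  have P_pos: "density_product p q i j > 0" if "1 \<le> i" "i < j" "j \<le> M" for i j
    using P[OF that] fM \<delta> by (meson divide_pos_pos less_le_trans)
  have pos: "p 1 > 0" "p j > 0" "q 1 j > 0" if "j \<in> {2..M}" for j
    using P_pos[of 1 j] that density_product_pos_factors[of A B j]
    unfolding p_def[abs_def] q_def[abs_def] by simp_all
  have "(\<Sum>j\<in>{2..M}. 1 / (t\<^sup>2 * (q 1 j * p j) * \<delta>)) \<le> (\<Sum>j\<in>{2..M}. p 1 / real M)"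
  proof (rule sum_mono)
    fix j assume j: "j \<in> {2..M}"
    then have "p 1 * p j * q 1 j \<ge> f M / \<delta>"
      using P[of 1 j] by (simp add: density_product_def)
    then show "1 / (t\<^sup>2 * (q 1 j * p j) * \<delta>) \<le> p 1 / real M"
      using pos[OF j] fM M \<delta> unfolding t_sq by (simp add: field_simps)
  qed
  also have "\<dots> = real (M - 1) * (p 1 / real M)" by simp
  also have "\<dots> < p 1" using pos(1)[of 2] M by (simp add: field_simps of_nat_diff)
  finally have small: "(\<Sum>j\<in>{2..M}. 1 / (t\<^sup>2 * (q 1 j * p j) * \<delta>)) < p 1" .
  obtain x where x: "x \<in> A 1"
    and rich: "\<And>j. j \<in> {2..M} \<Longrightarrow> set_density G {y \<in> A j. x \<otimes> y \<in> B 1 j} > (1 - t) * (q 1 j * p j)"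
  proof (rule exists_rich_vertex[OF fin, of "{2..M}" "A 1" "B 1" A \<delta> t])
    show "\<delta> > 0" "t > 0" by fact+
    show "\<And>d \<rho>. nontrivial_representation G d \<rho> \<Longrightarrow> \<delta> \<le> real d" by fact
    show "A 1 \<subseteq> carrier G" using Suc.prems(1)[of 1] by simp
    show "B 1 j \<subseteq> carrier G" "A j \<subseteq> carrier G" if "j \<in> {2..M}" for j
      using Suc.prems(1)[of j] Suc.prems(2)[of 1 j] that by (simp_all add: M_def)
    show "set_density G (B 1 j) > 0" "set_density G (A j) > 0" if "j \<in> {2..M}" for j
      using pos[OF that] by (simp_all add: p_def q_def)
    show "(\<Sum>j\<in>{2..M}. 1 / (t\<^sup>2 * (set_density G (B 1 j) * set_density G (A j)) * \<delta>))
        < set_density G (A 1)"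
      using small by (simp add: p_def q_def)
  qed (use that in \<open>auto simp: p_def q_def\<close>)
  define A' where "A' i = {y \<in> A (Suc i). x \<otimes> y \<in> B 1 (Suc i)}" for i
  define B' where "B' i j = B (Suc i) (Suc j)" for i j
  define p' where "p' i = set_density G (A' i)" for i
  have p'_ge: "p' i \<ge> (1 - t) * (q 1 (Suc i) * p (Suc i))" if "1 \<le> i" "i \<le> m" for i
    using rich[of "Suc i"] that by (simp add: p'_def A'_def M_def)
  have "density_product p' (\<lambda>k l. q (Suc k) (Suc l)) i j \<ge> f m / \<delta>"
    if ij: "1 \<le> i" "i < j" "j \<le> m" for i j
  proof -
    define R where "R = (\<Prod>k = 1..<i. q (Suc k) (Suc i) * q (Suc k) (Suc j))"
    define u where "u i = q 1 (Suc i) * p (Suc i)" for i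
    have q_nonneg: "q k l \<ge> 0" for k l by (simp add: q_def set_density_nonneg)
    have u_nonneg: "u i \<ge> 0" for i
      by (simp add: u_def p_def q_def set_density_nonneg)
    have R_nonneg: "R \<ge> 0" unfolding R_def by (intro prod_nonneg ballI mult_nonneg_nonneg q_nonneg)
    have "(\<Prod>k = 1..<Suc i. q k (Suc i) * q k (Suc j))
        = q 1 (Suc i) * q 1 (Suc j) * (\<Prod>k = Suc 1..<Suc i. q k (Suc i) * q k (Suc j))"
      using ij(1) by (intro prod.atLeast_Suc_lessThan) simp
    also have "(\<Prod>k = Suc 1..<Suc i. q k (Suc i) * q k (Suc j)) = R"
      unfolding R_def by (rule prod.shift_bounds_Suc_ivl)
    finally have full: "density_product p q (Suc i) (Suc j) = u i * u j * q (Suc i) (Suc j) * R"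
      by (simp add: density_product_def u_def)
    have "f m / \<delta> \<le> (1 - t)\<^sup>2 * f M / \<delta>"
      using f_step[of M] M \<delta> by (simp add: t_def M_def divide_right_mono)
    also have "\<dots> = (1 - t)\<^sup>2 * (f M / \<delta>)" by simp
    also have "\<dots> \<le> (1 - t)\<^sup>2 * density_product p q (Suc i) (Suc j)"
      using P[of "Suc i" "Suc j"] ij by (intro mult_left_mono) (simp_all add: M_def)
    also have "\<dots> = ((1 - t) * u i) * ((1 - t) * u j) * (q (Suc i) (Suc j) * R)"
      by (simp add: full power2_eq_square algebra_simps)
    also have "\<dots> \<le> (p' i * p' j) * (q (Suc i) (Suc j) * R)"
    proof (intro mult_right_mono mult_mono)
      show "(1 - t) * u i \<le> p' i" "(1 - t) * u j \<le> p' j"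
        using p'_ge[of i] p'_ge[of j] ij by (simp_all add: u_def)
      show "0 \<le> p' i" by (simp add: p'_def set_density_nonneg)
      show "0 \<le> (1 - t) * u j" using t_le u_nonneg by simp
      show "0 \<le> q (Suc i) (Suc j) * R" using q_nonneg R_nonneg by simp
    qed
    also have "\<dots> = density_product p' (\<lambda>k l. q (Suc k) (Suc l)) i j"
      by (simp add: density_product_def R_def)
    finally show ?thesis .
  qed
  then have P': "density_product (\<lambda>k. set_density G (A' k)) (\<lambda>k l. set_density G (B' k l)) i j
      \<ge> f m / \<delta>" if "1 \<le> i" "i < j" "j \<le> m" for i j
    using that by (simp add: p'_def[abs_def] q_def B'_def)
  have "\<exists>z. (\<forall>i. 1 \<le> i \<and> i \<le> m \<longrightarrow> z i \<in> A' i) \<and>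
    (\<forall>i j. 1 \<le> i \<and> i < j \<and> j \<le> m \<longrightarrow> z i \<otimes> z j \<in> B' i j)"
  proof (rule Suc.IH)
    show "A' i \<subseteq> carrier G" if "1 \<le> i" "i \<le> m" for i
      using Suc.prems(1)[of "Suc i"] that by (auto simp: A'_def)
    show "B' i j \<subseteq> carrier G" if "1 \<le> i" "i < j" "j \<le> m" for i j
      using Suc.prems(2)[of "Suc i" "Suc j"] that by (simp add: B'_def)
  qed (rule P')
  then obtain z where zA: "\<And>i. 1 \<le> i \<Longrightarrow> i \<le> m \<Longrightarrow> z i \<in> A' i"
    and zB: "\<And>i j. 1 \<le> i \<Longrightarrow> i < j \<Longrightarrow> j \<le> m \<Longrightarrow> z i \<otimes> z j \<in> B' i j"
    by blast
  \<comment> \<open>The shifted solution \<open>z\<close> supplies the indices from 2 on.\<close>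
  define w where "w i = (if i = 1 then x else z (i - 1))" for i
  have w_Suc: "w (Suc i) = z i" if "1 \<le> i" for i using that by (simp add: w_def)
  show ?case
  proof (intro exI[of _ w] conjI allI impI)
    fix i assume i: "1 \<le> i \<and> i \<le> Suc m"
    show "w i \<in> A i"
    proof (cases "i = 1")
      case True
      then show ?thesis using x by (simp add: w_def)
    next
      case False
      then obtain i' where "i = Suc i'" "1 \<le> i'" using i by (cases i) auto
      then show ?thesis using zA[of i'] i w_Suc by (simp add: A'_def)
    qed
  next
    fix i j assume ij: "1 \<le> i \<and> i < j \<and> j \<le> Suc m"
    then obtain j' where j': "j = Suc j'" "1 \<le> j'" "j' \<le> m" by (cases j) auto
    show "w i \<otimes> w j \<in> B i j"
    proof (cases "i = 1")
      case True
      then show ?thesis using zA[of j'] j' w_Suc by (simp add: A'_def w_def)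
    next
      case False
      then obtain i' where "i = Suc i'" "1 \<le> i'" using ij by (cases i) auto
      then show ?thesis using zB[of i' j'] ij j' w_Suc by (simp add: B'_def)
    qed
  qed
qed

end

theorem theorem13:
  fixes f :: "nat \<Rightarrow> real" and m :: nat and \<delta> :: real
    and G :: "('a, 'b) monoid_scheme" (structure)
    and A :: "nat \<Rightarrow> 'a set" and B :: "nat \<Rightarrow> nat \<Rightarrow> 'a set"
  assumes f_pos: "\<And>k. k \<ge> 2 \<Longrightarrow> f k > 0"
    and f_2: "f 2 > 1"
    and f_step: "\<And>k. k \<ge> 3 \<Longrightarrow> (1 - sqrt (real k / f k))\<^sup>2 * f k \<ge> f (k - 1)"
    and f_ge: "\<And>k. k \<ge> 3 \<Longrightarrow> f k \<ge> real k"
    and m: "m \<ge> 2"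
    and G: "group G" "finite (carrier G)"
    and \<delta>_pos: "\<delta> > 0"
    and no_small_rep: "\<not> (\<exists>d \<rho>. nontrivial_representation G d \<rho> \<and> real d < \<delta>)"
    and A: "\<And>i. 1 \<le> i \<Longrightarrow> i \<le> m \<Longrightarrow> A i \<subseteq> carrier G"
    and B: "\<And>i j. 1 \<le> i \<Longrightarrow> i < j \<Longrightarrow> j \<le> m \<Longrightarrow> B i j \<subseteq> carrier G"
    and P: "\<And>i j. 1 \<le> i \<Longrightarrow> i < j \<Longrightarrow> j \<le> m \<Longrightarrow>
      density_product (\<lambda>k. set_density G (A k)) (\<lambda>k l. set_density G (B k l)) i j \<ge> f m / \<delta>"
  shows "\<exists>x :: nat \<Rightarrow> 'a. (\<forall>i. 1 \<le> i \<and> i \<le> m \<longrightarrow> x i \<in> carrier G) \<and>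
    (\<forall>i j. 1 \<le> i \<and> i < j \<and> j \<le> m \<longrightarrow> x i \<otimes> x j \<in> B i j)"
proof -
  interpret group G by (rule G)
  have "\<delta> \<le> real d" if "nontrivial_representation G d \<rho>" for d \<rho>
    using no_small_rep that by force
  then obtain x where "\<And>i. 1 \<le> i \<Longrightarrow> i \<le> m \<Longrightarrow> x i \<in> A i"
    and "\<And>i j. 1 \<le> i \<Longrightarrow> i < j \<Longrightarrow> j \<le> m \<Longrightarrow> x i \<otimes> x j \<in> B i j"
    using exists_elements_with_prescribed_products[OF G(2) \<delta>_pos _ f_pos f_2 f_step f_ge m A B P]
    by blast
  with A show ?thesis by (intro exI[of _ x]) blast
qed

end
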